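(* Let $S$ be a semigroup and let $h\colon\mathscr{I}_{\infty}^{\nearrow}(\mathbb{N})\to S$ be a non-annihilating semigroup homomorphism. Then either $h$ is a monomorphism (i.e. injective) or the image of $\mathscr{I}_{\infty}^{\nearrow}(\mathbb{N})$ under $h$ is a cyclic subgroup of $S$.
   Context: $\mathbb{N}$ is the set of positive integers. $\mathscr{I}_{\infty}^{\nearrow}(\mathbb{N})$ is the set of all injective, order-preserving (hence strictly increasing) partial maps $\varphi\colon\mathbb{N}\rightharpoonup\mathbb{N}$ such that $\mathbb{N}\setminus\operatorname{dom}\varphi$ and $\mathbb{N}\setminus\operatorname{ran}\varphi$ are finite, where $\operatorname{ran}\varphi$ is the image of $\varphi$. The operation is composition of partial maps written on the right: $x(\alpha\beta)=(x\alpha)\beta$, with $\operatorname{dom}(\alpha\beta)=\{y\in\operatorname{dom}\alpha\mid y\alpha\in\operatorname{dom}\beta\}$. A homomorphism is annihilating if it is constant (its image is a single element), and non-annihilating otherwise. A subgroup of a semigroup $S$ is a subsemigroup of $S$ that is a group under the induced operation (its identity need not be an identity of $S$). *)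

theory Defs
  imports "HOL-Algebra.Elementary_Groups"
begin

(* The natural numbers of the source are the positive integers. *)
abbreviation pos_nats :: "nat set"
  where "pos_nats \<equiv> {1..}"

definition cofinite_monotone_injections :: "(nat \<rightharpoonup> nat) set"
  where "cofinite_monotone_injections =
    {\<phi>. dom \<phi> \<subseteq> pos_nats \<and> ran \<phi> \<subseteq> pos_nats \<and>
        inj_on \<phi> (dom \<phi>) \<and> mono_on (dom \<phi>) (\<lambda>x. the (\<phi> x)) \<and>
        finite (pos_nats - dom \<phi>) \<and> finite (pos_nats - ran \<phi>)}"

(* Maps act on the right, so the product of \<alpha> and \<beta> applies \<alpha> first;
   map_comp takes its arguments in the opposite order. *)
definition cofinite_monotone_injection_monoid :: "(nat \<rightharpoonup> nat) monoid"
  where "cofinite_monotone_injection_monoid =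
    \<lparr>carrier = cofinite_monotone_injections,
     mult = (\<lambda>\<alpha> \<beta>. \<beta> \<circ>\<^sub>m \<alpha>),
     one = (\<lambda>x. if x \<in> pos_nats then Some x else None)\<rparr>"

(* The record type carries a field one, but nothing is required of it here. *)
locale semigroup_structure =
  fixes S (structure)
  assumes m_closed: "\<lbrakk>x \<in> carrier S; y \<in> carrier S\<rbrakk> \<Longrightarrow> x \<otimes> y \<in> carrier S"
    and m_assoc: "\<lbrakk>x \<in> carrier S; y \<in> carrier S; z \<in> carrier S\<rbrakk>
      \<Longrightarrow> (x \<otimes> y) \<otimes> z = x \<otimes> (y \<otimes> z)"

definition annihilating :: "('a, 'c) monoid_scheme \<Rightarrow> ('a \<Rightarrow> 'b) \<Rightarrow> bool"
  where "annihilating G h \<longleftrightarrow> (\<exists>c. h ` carrier G = {c})"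

(* The identity e of the subgroup need not be an identity of S, so the field one
   of S is overwritten. Inverses and powers in the updated record are then taken
   relative to H and e. *)
definition cyclic_subgroup_of_semigroup :: "'a set \<Rightarrow> ('a, 'b) monoid_scheme \<Rightarrow> bool"
  where "cyclic_subgroup_of_semigroup H S \<longleftrightarrow>
    H \<subseteq> carrier S \<and>
    (\<exists>e\<in>H. group (S\<lparr>carrier := H, one := e\<rparr>) \<and> cyclic_group (S\<lparr>carrier := H, one := e\<rparr>))"

end

theory Submission
  imports Defs
begin

text \<open>
  Write \<open>\<alpha>\<beta>\<close> for the product that applies \<open>\<alpha>\<close> first, \<open>1\<close> for the identity map, and
  \<open>[p \<rightarrow> q]\<close> for the map \<open>p + i \<mapsto> q + i\<close> with domain \<open>{p..}\<close> (\<open>tail_shift p q\<close> below).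
  These tail shifts form a copy of the bicyclic monoid, \<open>[p \<rightarrow> q][q \<rightarrow> r] = [p \<rightarrow> r]\<close>, and
  far enough out every cofinite monotone injection agrees with one of them. So
  \<open>[p \<rightarrow> p]\<alpha> = [p \<rightarrow> q]\<close> for suitable \<open>p\<close> and \<open>q\<close>, and a map is determined up to a finite
  part by the displacement \<open>q - p\<close>.

  Suppose \<open>h\<close> identifies two different maps \<open>\<alpha>\<close> and \<open>\<beta>\<close>, say \<open>\<alpha>\<close> sends \<open>k\<close> to \<open>m\<close> and
  \<open>\<beta>\<close> does not. Restricting to \<open>k\<close> together with a far tail, and renumbering the points
  that remain on both sides, turns \<open>\<alpha>\<close> into \<open>1\<close> and \<open>\<beta>\<close> into some \<open>\<theta>\<close> that does not fix \<open>1\<close>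
  (\<open>compress_to_one\<close>). By monotonicity \<open>\<theta>\<close> cannot have \<open>1\<close> in both its domain and its
  range, so multiplying \<open>\<theta>\<close> by \<open>[2 \<rightarrow> 2]\<close> on one of the two sides changes nothing
  (\<open>not_one_fixed_absorbs\<close>). Since \<open>h \<theta> = h 1\<close>, this forces \<open>h [2 \<rightarrow> 2] = h 1\<close>.

  Conjugating by shifts then gives \<open>h [p \<rightarrow> p] = h 1\<close> for every \<open>p\<close>, so the image of \<open>h\<close>
  consists of the elements \<open>h [p \<rightarrow> q]\<close>. Here \<open>h [p \<rightarrow> q]\<close> and \<open>h [q \<rightarrow> p]\<close> are mutually
  inverse, and \<open>h [p \<rightarrow> q]\<close> is the power of \<open>h [1 \<rightarrow> 2]\<close> with exponent \<open>q - p\<close>: the image is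
  a cyclic group. Thus \<open>h\<close> is injective or has a cyclic group as image.
\<close>

section \<open>Cofinite monotone injections are shifts far out\<close>

definition tail_shift :: "nat \<Rightarrow> nat \<Rightarrow> (nat \<rightharpoonup> nat)"
  where "tail_shift p q = (\<lambda>x. if p \<le> x then Some (x - p + q) else None)"

text \<open>
  Far out, both \<open>x\<close> and its image lie beyond all gaps of the domain and of the range. There
  \<open>\<alpha>\<close> cannot skip a value: the point mapped to \<open>\<alpha> x + 1\<close> lies beyond \<open>x\<close>, hence is
  \<open>x + 1\<close>.
\<close>
lemma cofinite_monotone_injection_eventually_shift:
  assumes "\<alpha> \<in> cofinite_monotone_injections"
  obtains p q where "\<And>i. \<alpha> (p + i) = Some (q + i)"
proof -
  let ?f = "\<lambda>x. the (\<alpha> x)"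
  have inj: "inj_on \<alpha> (dom \<alpha>)" and mono: "mono_on (dom \<alpha>) ?f"
    and "finite (pos_nats - dom \<alpha>)" "finite (pos_nats - ran \<alpha>)"
    using assms by (auto simp: cofinite_monotone_injections_def)
  then obtain n r where n: "\<And>x. x \<in> pos_nats - dom \<alpha> \<Longrightarrow> x < n"
    and r: "\<And>y. y \<in> pos_nats - ran \<alpha> \<Longrightarrow> y < r"
    by (metis finite_nat_set_iff_bounded)
  have dom: "x \<in> dom \<alpha>" if "Suc n \<le> x" for x
    using n[of x] that by fastforce
  have strict: "?f x < ?f y" if "x \<in> dom \<alpha>" "y \<in> dom \<alpha>" "x < y" for x y
  proof -
    have "?f x \<le> ?f y" using mono that by (auto dest: mono_onD)
    moreover have "?f x \<noteq> ?f y" using inj that unfolding inj_on_def by (metis domD nat_neq_iff option.sel)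
    ultimately show ?thesis by simp
  qed
  have grow: "i \<le> ?f (Suc n + i)" for i
  proof (induction i)
    case (Suc i)
    have "?f (Suc n + i) < ?f (Suc n + Suc i)" by (intro strict dom) simp_all
    with Suc show ?case by linarith
  qed simp
  \<comment> \<open>From \<open>p\<close> on, \<open>grow\<close> pushes the values past every gap of the range.\<close>
  define p where "p = Suc n + Suc r"
  have step: "?f (Suc x) = Suc (?f x)" if "p \<le> x" for x
  proof -
    have x: "x \<in> dom \<alpha>" "Suc x \<in> dom \<alpha>" using dom that by (auto simp: p_def)
    have "r \<le> ?f x" using grow[of "x - Suc n"] that by (simp add: p_def)
    then have "Suc (?f x) \<in> ran \<alpha>" using r[of "Suc (?f x)"] by fastforce
    then obtain y where y: "\<alpha> y = Some (Suc (?f x))" by (auto simp: ran_def)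
    then have "y \<in> dom \<alpha>" "?f y = Suc (?f x)" by auto
    then have "x < y" using strict[of y x] x by (metis Suc_n_not_le_n less_or_eq_imp_le linorder_neqE_nat)
    then have "?f (Suc x) \<le> ?f y"
      using x \<open>y \<in> dom \<alpha>\<close> mono by (auto dest: mono_onD)
    with \<open>?f y = Suc (?f x)\<close> strict[of x "Suc x"] x show ?thesis by simp
  qed
  have "?f (p + i) = ?f p + i" for i
    by (induction i) (use step in auto)
  moreover have "p + i \<in> dom \<alpha>" for i by (rule dom) (simp add: p_def)
  ultimately have "\<alpha> (p + i) = Some (?f p + i)" for i by (metis domD option.sel)
  then show ?thesis by (rule that)
qed

text \<open>
  Trading the two finiteness conditions for an eventual shift makes closure under composition
  a matter of adding offsets, with no counting of complements.
\<close>
lemma mem_cofinite_monotone_injections_iff: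
  "\<alpha> \<in> cofinite_monotone_injections \<longleftrightarrow>
    (\<forall>x a. \<alpha> x = Some a \<longrightarrow> 1 \<le> x \<and> 1 \<le> a) \<and>
    (\<forall>x y a b. \<alpha> x = Some a \<longrightarrow> \<alpha> y = Some b \<longrightarrow> x < y \<longrightarrow> a < b) \<and>
    (\<exists>p q. \<forall>i. \<alpha> (p + i) = Some (q + i))" (is "_ \<longleftrightarrow> ?pos \<and> ?strict \<and> ?tail")
proof
  assume \<alpha>: "\<alpha> \<in> cofinite_monotone_injections"
  then have ?tail by (metis cofinite_monotone_injection_eventually_shift)
  moreover have ?pos using \<alpha> by (auto simp: cofinite_monotone_injections_def ran_def subset_iff)
  moreover have ?strict
  proof (intro allI impI)
    fix x y a b assume xy: "\<alpha> x = Some a" "\<alpha> y = Some b" "x < y"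
    from \<alpha> have inj: "inj_on \<alpha> (dom \<alpha>)" and mono: "mono_on (dom \<alpha>) (\<lambda>x. the (\<alpha> x))"
      by (auto simp: cofinite_monotone_injections_def)
    have "a \<le> b" using mono_onD[OF mono, of x y] xy by auto
    moreover have "a \<noteq> b" using inj_onD[OF inj, of x y] xy by auto
    ultimately show "a < b" by simp
  qed
  ultimately show "?pos \<and> ?strict \<and> ?tail" by blast
next
  assume "?pos \<and> ?strict \<and> ?tail"
  then obtain p q where pos: ?pos and strict: ?strict and tail: "\<And>i. \<alpha> (p + i) = Some (q + i)"
    by blast
  have "\<alpha> x = Some (x - p + q)" if "p \<le> x" for x
    using tail[of "x - p"] that by (simp add: add.commute)
  then have "pos_nats - dom \<alpha> \<subseteq> {..<p}" by (force simp: not_le[symmetric])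
  moreover have "pos_nats - ran \<alpha> \<subseteq> {..<q}"
  proof
    fix y assume y: "y \<in> pos_nats - ran \<alpha>"
    then show "y \<in> {..<q}" using tail[of "y - q"] by (auto simp: ran_def not_le[symmetric])
  qed
  ultimately have "finite (pos_nats - dom \<alpha>)" "finite (pos_nats - ran \<alpha>)"
    by (auto intro: finite_subset)
  moreover have "inj_on \<alpha> (dom \<alpha>)"
    using strict by (auto simp: inj_on_def) (metis less_irrefl linorder_neqE_nat)
  moreover have "mono_on (dom \<alpha>) (\<lambda>x. the (\<alpha> x))"
    using strict by (fastforce simp: mono_on_def le_less)
  ultimately show "\<alpha> \<in> cofinite_monotone_injections"
    using pos by (auto simp: cofinite_monotone_injections_def ran_def subset_iff)
qed

lemma positive:
  "\<alpha> \<in> cofinite_monotone_injections \<Longrightarrow> \<alpha> x = Some a \<Longrightarrow> 1 \<le> x \<and> 1 \<le> a"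
  by (simp add: mem_cofinite_monotone_injections_iff)

lemma strictly_increasing:
  "\<alpha> \<in> cofinite_monotone_injections \<Longrightarrow> \<alpha> x = Some a \<Longrightarrow> \<alpha> y = Some b \<Longrightarrow> x < y \<Longrightarrow> a < b"
  unfolding mem_cofinite_monotone_injections_iff by blast

lemma tail_shift_mem: "1 \<le> p \<Longrightarrow> 1 \<le> q \<Longrightarrow> tail_shift p q \<in> cofinite_monotone_injections"
  unfolding mem_cofinite_monotone_injections_iff
proof (intro conjI)
  have "tail_shift p q (p + i) = Some (q + i)" for i
    by (simp add: tail_shift_def)
  then show "\<exists>p' q'. \<forall>i. tail_shift p q (p' + i) = Some (q' + i)" by blast
qed (auto simp: tail_shift_def split: if_splits)

text \<open>These maps place one point apart from the tail, so they can insert or remove the gap between them.\<close>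
lemma tail_shift_upd_mem:
  assumes "1 \<le> k" "k < p" "1 \<le> m" "m < q"
  shows "(tail_shift p q)(k \<mapsto> m) \<in> cofinite_monotone_injections"
  unfolding mem_cofinite_monotone_injections_iff
proof (intro conjI)
  have "((tail_shift p q)(k \<mapsto> m)) (p + i) = Some (q + i)" for i
    using assms by (simp add: tail_shift_def)
  then show "\<exists>p' q'. \<forall>i. ((tail_shift p q)(k \<mapsto> m)) (p' + i) = Some (q' + i)" by blast
qed (use assms in \<open>auto simp: tail_shift_def split: if_splits\<close>)

lemma comp_mem:
  assumes "\<alpha> \<in> cofinite_monotone_injections" "\<beta> \<in> cofinite_monotone_injections"
  shows "\<beta> \<circ>\<^sub>m \<alpha> \<in> cofinite_monotone_injections"
proof -
  obtain p q where \<alpha>: "\<And>i. \<alpha> (p + i) = Some (q + i)"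
    using assms(1) by (rule cofinite_monotone_injection_eventually_shift) blast
  obtain p' q' where \<beta>: "\<And>i. \<beta> (p' + i) = Some (q' + i)"
    using assms(2) by (rule cofinite_monotone_injection_eventually_shift) blast
  have "(\<beta> \<circ>\<^sub>m \<alpha>) (p + p' + i) = Some (q' + q + i)" for i
    using \<alpha>[of "p' + i"] \<beta>[of "q + i"] by (simp add: map_comp_def ac_simps)
  then have "\<exists>p q. \<forall>i. (\<beta> \<circ>\<^sub>m \<alpha>) (p + i) = Some (q + i)" by blast
  moreover have "1 \<le> x \<and> 1 \<le> a" if "(\<beta> \<circ>\<^sub>m \<alpha>) x = Some a" for x a
    using that positive[OF assms(1)] positive[OF assms(2)] by (auto simp: map_comp_Some_iff)
  moreover have "a < b"
    if "(\<beta> \<circ>\<^sub>m \<alpha>) x = Some a" "(\<beta> \<circ>\<^sub>m \<alpha>) y = Some b" "x < y" for x y a b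
    using that strictly_increasing[OF assms(1)] strictly_increasing[OF assms(2)]
    by (auto simp: map_comp_Some_iff)
  ultimately show ?thesis
    unfolding mem_cofinite_monotone_injections_iff by blast
qed

lemma tail_shift_comp: "tail_shift q r \<circ>\<^sub>m tail_shift p q = tail_shift p r"
  by (rule ext) (auto simp: tail_shift_def map_comp_def)

lemma one_comp:
  assumes "\<alpha> \<in> cofinite_monotone_injections"
  shows "\<alpha> \<circ>\<^sub>m tail_shift 1 1 = \<alpha>"
proof
  fix x
  have "1 \<le> x" if "\<alpha> x = Some a" for a
    using positive[OF assms that] by simp
  then show "(\<alpha> \<circ>\<^sub>m tail_shift 1 1) x = \<alpha> x"
    by (cases "\<alpha> x") (auto simp: tail_shift_def map_comp_def)
qed

lemma comp_one:
  assumes "\<alpha> \<in> cofinite_monotone_injections"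
  shows "tail_shift 1 1 \<circ>\<^sub>m \<alpha> = \<alpha>"
proof
  fix x
  have "1 \<le> a" if "\<alpha> x = Some a" for a
    using positive[OF assms that] by simp
  then show "(tail_shift 1 1 \<circ>\<^sub>m \<alpha>) x = \<alpha> x"
    by (cases "\<alpha> x") (auto simp: tail_shift_def map_comp_def)
qed

section \<open>Separating two maps at the point 1\<close>

text \<open>
  If \<open>1\<close> is a value of \<open>\<theta>\<close>, it is taken at some \<open>y > 1\<close>; then \<open>\<theta>\<close> is undefined at \<open>1\<close>,
  because a value there would have to be below \<open>1\<close>. So \<open>1\<close> is missing from the domain or
  from the range, and restricting that side to \<open>{2..}\<close> loses nothing.
\<close>
lemma not_one_fixed_absorbs:
  assumes "\<theta> \<in> cofinite_monotone_injections" "\<theta> 1 \<noteq> Some 1"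
  shows "\<theta> \<circ>\<^sub>m tail_shift 2 2 = \<theta> \<or> tail_shift 2 2 \<circ>\<^sub>m \<theta> = \<theta>"
proof (cases "1 \<in> ran \<theta>")
  case True
  then obtain y where y: "\<theta> y = Some 1" by (auto simp: ran_def)
  have pos: "1 \<le> x \<and> 1 \<le> a" if "\<theta> x = Some a" for x a
    using positive[OF assms(1) that] .
  have "1 < y" using assms(2) y pos[OF y] by (cases "y = 1") auto
  have "\<theta> x = None" if "x < 2" for x
  proof (rule ccontr)
    assume "\<theta> x \<noteq> None"
    then obtain a where a: "\<theta> x = Some a" by blast
    have "x < y" using \<open>1 < y\<close> that by simp
    with a y have "a < 1" using strictly_increasing[OF assms(1)] by blast
    with pos[OF a] show False by simp
  qed
  then have "\<theta> \<circ>\<^sub>m tail_shift 2 2 = \<theta>"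
    by (intro ext) (auto simp: tail_shift_def map_comp_def simp del: add_2_eq_Suc')
  then show ?thesis ..
next
  case False
  have "2 \<le> a" if "\<theta> x = Some a" for x a
  proof -
    have "1 \<le> a" using positive[OF assms(1) that] by simp
    moreover have "a \<noteq> 1" using False that by (auto simp: ran_def)
    ultimately show ?thesis by simp
  qed
  then have "(tail_shift 2 2 \<circ>\<^sub>m \<theta>) x = \<theta> x" for x
    by (cases "\<theta> x") (auto simp: tail_shift_def map_comp_def simp del: add_2_eq_Suc')
  then have "tail_shift 2 2 \<circ>\<^sub>m \<theta> = \<theta>" ..
  then show ?thesis ..
qed

text \<open>
  The factor \<open>\<kappa>\<close> lists \<open>k\<close> followed by a tail of the domain on which \<open>\<alpha>\<close> is a shift, and
  \<open>\<rho>\<close> renumbers \<open>m\<close> followed by the image of that tail, so that \<open>\<alpha>\<close> becomes the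
  identity. As \<open>\<kappa>\<close> sends \<open>1\<close> to \<open>k\<close>, and \<open>\<rho>\<close> sends only \<open>m\<close> to \<open>1\<close>, the same two
  factors detect whether any other map sends \<open>k\<close> to \<open>m\<close>.
\<close>
lemma compress_to_one:
  assumes "\<alpha> \<in> cofinite_monotone_injections" "\<alpha> k = Some m"
  obtains \<kappa> \<rho> where "\<kappa> \<in> cofinite_monotone_injections" "\<rho> \<in> cofinite_monotone_injections"
    "\<rho> \<circ>\<^sub>m (\<alpha> \<circ>\<^sub>m \<kappa>) = tail_shift 1 1"
    "\<And>\<beta>. (\<rho> \<circ>\<^sub>m (\<beta> \<circ>\<^sub>m \<kappa>)) 1 = Some 1 \<Longrightarrow> \<beta> k = Some m"
proof -
  obtain p' q' where t: "\<And>i. \<alpha> (p' + i) = Some (q' + i)"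
    using assms(1) by (rule cofinite_monotone_injection_eventually_shift) blast
  \<comment> \<open>The tail is cut off past \<open>k\<close>, so that \<open>\<kappa>\<close> is increasing.\<close>
  define p q where "p = p' + Suc k" and "q = q' + Suc k"
  have tail: "\<alpha> (p + i) = Some (q + i)" for i
    using t[of "Suc k + i"] by (simp add: p_def q_def add.assoc)
  have km: "1 \<le> k" "1 \<le> m"
    using positive[OF assms] by auto
  have kp: "k < p" by (simp add: p_def)
  have mq: "m < q" using strictly_increasing[OF assms _ kp] tail[of 0] by simp
  let ?l = "(tail_shift 2 p)(1 \<mapsto> k)" and ?r = "(tail_shift q 2)(m \<mapsto> 1)"
  have "?r \<circ>\<^sub>m (\<alpha> \<circ>\<^sub>m ?l) = tail_shift 1 1"
  proof
    fix x :: nat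
    consider "x = 0" | "x = 1" | i where "x = 2 + i"
      by (metis One_nat_def add_2_eq_Suc not0_implies_Suc)
    then show "(?r \<circ>\<^sub>m (\<alpha> \<circ>\<^sub>m ?l)) x = tail_shift 1 1 x"
      using assms(2) mq tail by cases (auto simp: tail_shift_def map_comp_def add.commute)
  qed
  moreover have "\<beta> k = Some m" if "(?r \<circ>\<^sub>m (\<beta> \<circ>\<^sub>m ?l)) 1 = Some 1" for \<beta>
    using that by (auto simp: tail_shift_def map_comp_def split: option.splits if_splits)
  ultimately show ?thesis
    using that[of ?l ?r] tail_shift_upd_mem[of 1 2 k p] tail_shift_upd_mem[of m q 1 2] km kp mq
    by simp
qed

section \<open>Homomorphisms that are not injective\<close>

locale cofinite_monotone_injection_hom = semigroup_structure S for S (structure) +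
  fixes h :: "(nat \<rightharpoonup> nat) \<Rightarrow> 'a"
  assumes h_hom: "h \<in> hom cofinite_monotone_injection_monoid S"
begin

lemma h_closed: "\<alpha> \<in> cofinite_monotone_injections \<Longrightarrow> h \<alpha> \<in> carrier S"
  using h_hom by (auto simp: hom_def cofinite_monotone_injection_monoid_def)

lemma h_comp:
  "\<alpha> \<in> cofinite_monotone_injections \<Longrightarrow> \<beta> \<in> cofinite_monotone_injections
    \<Longrightarrow> h (\<beta> \<circ>\<^sub>m \<alpha>) = h \<alpha> \<otimes> h \<beta>"
  using h_hom by (auto simp: hom_def cofinite_monotone_injection_monoid_def)

lemma h_tail_shift_comp:
  assumes "1 \<le> p" "1 \<le> q" "1 \<le> r"
  shows "h (tail_shift p q) \<otimes> h (tail_shift q r) = h (tail_shift p r)"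
  using h_comp[of "tail_shift p q" "tail_shift q r"] assms
  by (simp add: tail_shift_mem tail_shift_comp)

text \<open>
  The product of \<open>\<theta>\<close> and \<open>[2 \<rightarrow> 2]\<close>, on the side where \<open>\<theta>\<close> absorbs it, has image \<open>h \<theta>\<close>;
  replacing \<open>h \<theta>\<close> by \<open>h 1\<close> in this product, its image is also \<open>h [2 \<rightarrow> 2]\<close>.
\<close>
lemma collapse_at_one:
  assumes \<alpha>: "\<alpha> \<in> cofinite_monotone_injections" and \<beta>: "\<beta> \<in> cofinite_monotone_injections"
    and eq: "h \<alpha> = h \<beta>" and "\<alpha> k = Some m" "\<beta> k \<noteq> Some m"
  shows "h (tail_shift 2 2) = h (tail_shift 1 1)"
proof -
  from \<alpha> \<open>\<alpha> k = Some m\<close> obtain \<kappa> \<rho> where l: "\<kappa> \<in> cofinite_monotone_injections"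
    and r: "\<rho> \<in> cofinite_monotone_injections"
    and one: "\<rho> \<circ>\<^sub>m (\<alpha> \<circ>\<^sub>m \<kappa>) = tail_shift 1 1"
    and fix1: "\<And>\<beta>. (\<rho> \<circ>\<^sub>m (\<beta> \<circ>\<^sub>m \<kappa>)) 1 = Some 1 \<Longrightarrow> \<beta> k = Some m"
    using compress_to_one by blast
  define \<theta> where "\<theta> = \<rho> \<circ>\<^sub>m (\<beta> \<circ>\<^sub>m \<kappa>)"
  have \<theta>: "\<theta> \<in> cofinite_monotone_injections" by (simp add: \<theta>_def comp_mem l r \<beta>)
  have h\<theta>: "h \<theta> = h (tail_shift 1 1)"
    unfolding \<theta>_def one[symmetric] by (simp add: h_comp comp_mem l r \<alpha> \<beta> eq)
  have e: "tail_shift 2 2 \<in> cofinite_monotone_injections"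
    "tail_shift 1 1 \<in> cofinite_monotone_injections" by (simp_all add: tail_shift_mem)
  have "\<theta> 1 \<noteq> Some 1" using fix1 \<open>\<beta> k \<noteq> Some m\<close> by (auto simp: \<theta>_def)
  with \<theta> consider "\<theta> \<circ>\<^sub>m tail_shift 2 2 = \<theta>" | "tail_shift 2 2 \<circ>\<^sub>m \<theta> = \<theta>"
    using not_one_fixed_absorbs by blast
  then show ?thesis
  proof cases
    case 1
    have "h (tail_shift 2 2) = h (tail_shift 2 2) \<otimes> h \<theta>"
      using h_comp[OF e(1) e(2)] comp_one[OF e(1)] h\<theta> by simp
    also have "\<dots> = h \<theta>" using h_comp[OF e(1) \<theta>] 1 by simp
    finally show ?thesis using h\<theta> by simp
  next
    case 2
    have "h (tail_shift 2 2) = h \<theta> \<otimes> h (tail_shift 2 2)"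
      using h_comp[OF e(2) e(1)] one_comp[OF e(1)] h\<theta> by simp
    also have "\<dots> = h \<theta>" using h_comp[OF \<theta> e(1)] 2 by simp
    finally show ?thesis using h\<theta> by simp
  qed
qed

lemma noninjective_collapse:
  assumes "\<not> inj_on h cofinite_monotone_injections"
  shows "h (tail_shift 2 2) = h (tail_shift 1 1)"
proof -
  from assms obtain \<alpha> \<beta> where ab: "\<alpha> \<in> cofinite_monotone_injections"
    "\<beta> \<in> cofinite_monotone_injections" "h \<alpha> = h \<beta>" "\<alpha> \<noteq> \<beta>"
    by (auto simp: inj_on_def)
  then obtain k where "\<alpha> k \<noteq> \<beta> k" by blast
  then obtain m where "(\<alpha> k = Some m \<and> \<beta> k \<noteq> Some m) \<or> (\<beta> k = Some m \<and> \<alpha> k \<noteq> Some m)"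
    by (metis option.exhaust)
  with ab show ?thesis using collapse_at_one[of \<alpha> \<beta> k m] collapse_at_one[of \<beta> \<alpha> k m] by auto
qed

text \<open>Conjugation by \<open>[n \<rightarrow> 1]\<close> carries \<open>1\<close> to \<open>[n \<rightarrow> n]\<close> and \<open>[2 \<rightarrow> 2]\<close> to \<open>[n + 1 \<rightarrow> n + 1]\<close>.\<close>
lemma collapse_propagates:
  assumes "h (tail_shift 2 2) = h (tail_shift 1 1)" "1 \<le> n"
  shows "h (tail_shift n n) = h (tail_shift 1 1)"
  using \<open>1 \<le> n\<close>
proof (induction n rule: dec_induct)
  case (step n)
  have "h (tail_shift n n) = h (tail_shift n 1) \<otimes> h (tail_shift 1 1) \<otimes> h (tail_shift 1 n)"
    using step by (simp add: h_tail_shift_comp)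
  also have "\<dots> = h (tail_shift n 1) \<otimes> h (tail_shift 2 2) \<otimes> h (tail_shift 1 n)"
    using assms(1) by simp
  also have "\<dots> = h (tail_shift 1 n \<circ>\<^sub>m (tail_shift 2 2 \<circ>\<^sub>m tail_shift n 1))"
    using step by (simp add: h_comp tail_shift_mem comp_mem)
  also have "tail_shift 1 n \<circ>\<^sub>m (tail_shift 2 2 \<circ>\<^sub>m tail_shift n 1) = tail_shift (Suc n) (Suc n)"
    using step.hyps by (intro ext) (auto simp: tail_shift_def map_comp_def)
  finally show ?case using step by simp
qed simp

text \<open>Once \<open>h [p \<rightarrow> p] = h 1\<close>, cutting a map down to its tail does not change its image.\<close>
lemma collapse_imp_tail_shift:
  assumes "h (tail_shift 2 2) = h (tail_shift 1 1)" "\<alpha> \<in> cofinite_monotone_injections"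
  obtains p q where "1 \<le> p" "1 \<le> q" "h \<alpha> = h (tail_shift p q)"
proof -
  obtain p q where t: "\<And>i. \<alpha> (p + i) = Some (q + i)"
    using assms(2) by (rule cofinite_monotone_injection_eventually_shift) blast
  have pq: "1 \<le> p" "1 \<le> q"
    using positive[OF assms(2) t[of 0]] by auto
  have tail: "\<alpha> \<circ>\<^sub>m tail_shift p p = tail_shift p q"
  proof
    fix x
    show "(\<alpha> \<circ>\<^sub>m tail_shift p p) x = tail_shift p q x"
      using t[of "x - p"] by (auto simp: tail_shift_def map_comp_def add.commute)
  qed
  have "h \<alpha> = h (tail_shift 1 1) \<otimes> h \<alpha>"
    using h_comp[of "tail_shift 1 1" \<alpha>] assms(2) by (simp add: one_comp[unfolded One_nat_def] tail_shift_mem)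
  also have "\<dots> = h (tail_shift p p) \<otimes> h \<alpha>"
    using collapse_propagates[OF assms(1) pq(1)] by simp
  also have "\<dots> = h (tail_shift p q)"
    using h_comp[of "tail_shift p p" \<alpha>] assms(2) pq by (simp add: tail tail_shift_mem)
  finally show ?thesis using that pq by blast
qed

text \<open>
  In the image, \<open>[p \<rightarrow> q]\<close> and \<open>[q \<rightarrow> p]\<close> become inverse to each other. The exponent of
  \<open>h [p \<rightarrow> q]\<close> comes from solving \<open>a^(p - 1) \<otimes> h [p \<rightarrow> q] = a^(q - 1)\<close> for \<open>a = h [1 \<rightarrow> 2]\<close>,
  which is the image of \<open>[1 \<rightarrow> p][p \<rightarrow> q] = [1 \<rightarrow> q]\<close>.
\<close>
lemma collapse_imp_cyclic_subgroup:
  assumes collapse: "h (tail_shift 2 2) = h (tail_shift 1 1)"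
  shows "cyclic_subgroup_of_semigroup (h ` cofinite_monotone_injections) S"
proof -
  let ?T = "S\<lparr>carrier := h ` cofinite_monotone_injections, one := h (tail_shift 1 1)\<rparr>"
  note idem = collapse_propagates[OF collapse]
  have one_mem: "tail_shift 1 1 \<in> cofinite_monotone_injections" by (simp add: tail_shift_mem)
  have T_group: "group ?T"
  proof (rule groupI)
    fix x y assume "x \<in> carrier ?T" "y \<in> carrier ?T"
    then show "x \<otimes>\<^bsub>?T\<^esub> y \<in> carrier ?T"
      by (auto simp: h_comp[symmetric] comp_mem)
  next
    fix x assume x: "x \<in> carrier ?T"
    then show "\<one>\<^bsub>?T\<^esub> \<otimes>\<^bsub>?T\<^esub> x = x"
      using one_comp one_mem by (auto simp: h_comp[symmetric])
    from x obtain p q where pq: "1 \<le> p" "1 \<le> q" "x = h (tail_shift p q)"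
      using collapse_imp_tail_shift[OF collapse] by auto
    then have "h (tail_shift q p) \<otimes> x = h (tail_shift 1 1)"
      using idem[of q] by (simp add: h_tail_shift_comp)
    then show "\<exists>y\<in>carrier ?T. y \<otimes>\<^bsub>?T\<^esub> x = \<one>\<^bsub>?T\<^esub>"
      using pq by (auto simp: tail_shift_mem)
  qed (use one_mem in \<open>auto intro!: m_assoc h_closed\<close>)
  then interpret T: group ?T .
  define a where "a = h (tail_shift 1 2)"
  have a_mem: "a \<in> carrier ?T" by (simp add: a_def tail_shift_mem)
  have pow: "a [^]\<^bsub>?T\<^esub> n = h (tail_shift 1 (Suc n))" for n :: nat
  proof (induction n)
    case (Suc n)
    have "tail_shift 1 2 \<circ>\<^sub>m tail_shift 1 (Suc n) = tail_shift 1 (Suc (Suc n))"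
      by (auto simp: tail_shift_def map_comp_def)
    then show ?case using Suc h_comp[of "tail_shift 1 (Suc n)" "tail_shift 1 2"]
      by (simp add: a_def tail_shift_mem)
  qed simp
  have "x \<in> range (\<lambda>n::int. a [^]\<^bsub>?T\<^esub> n)" if x: "x \<in> carrier ?T" for x
  proof -
    from x obtain p q where pq: "1 \<le> p" "1 \<le> q" "x = h (tail_shift p q)"
      using collapse_imp_tail_shift[OF collapse] by auto
    have "a [^]\<^bsub>?T\<^esub> (p - 1) \<otimes>\<^bsub>?T\<^esub> x = a [^]\<^bsub>?T\<^esub> (q - 1)"
      using pq h_tail_shift_comp[of 1 p q] by (simp only: pow) simp
    then have "a [^]\<^bsub>?T\<^esub> int (p - 1) \<otimes>\<^bsub>?T\<^esub> x = a [^]\<^bsub>?T\<^esub> int (q - 1)"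
      by (simp only: int_pow_int)
    also have "\<dots> = a [^]\<^bsub>?T\<^esub> int (p - 1) \<otimes>\<^bsub>?T\<^esub> a [^]\<^bsub>?T\<^esub> (int (q - 1) - int (p - 1))"
      using T.int_pow_mult[OF a_mem, of "int (p - 1)" "int (q - 1) - int (p - 1)"] by simp
    finally have "x = a [^]\<^bsub>?T\<^esub> (int (q - 1) - int (p - 1))"
      using T.Units_l_cancel[OF _ x T.int_pow_closed[OF a_mem]] T.int_pow_closed[OF a_mem]
      unfolding T.Units_eq by blast
    then show ?thesis by blast
  qed
  then have "carrier ?T = range (\<lambda>n::int. a [^]\<^bsub>?T\<^esub> n)"
    using T.int_pow_closed[OF a_mem] by blast
  then have "cyclic_group ?T"
    using a_mem unfolding T.cyclic_group by blast
  then show ?thesis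
    using T_group one_mem h_closed unfolding cyclic_subgroup_of_semigroup_def by blast
qed

end

theorem theorem2p9:
  fixes S :: "('a, 'b) monoid_scheme"
    and h :: "(nat \<rightharpoonup> nat) \<Rightarrow> 'a"
  assumes "semigroup_structure S"
    and "h \<in> hom cofinite_monotone_injection_monoid S"
    and "\<not> annihilating cofinite_monotone_injection_monoid h"
  shows "h \<in> mon cofinite_monotone_injection_monoid S \<or>
         cyclic_subgroup_of_semigroup (h ` carrier cofinite_monotone_injection_monoid) S"
proof -
  have carrier: "carrier cofinite_monotone_injection_monoid = cofinite_monotone_injections"
    by (simp add: cofinite_monotone_injection_monoid_def)
  interpret cofinite_monotone_injection_hom S h
    using assms(1,2) by (simp add: cofinite_monotone_injection_hom_def cofinite_monotone_injection_hom_axioms_def)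
  show ?thesis
  proof (cases "inj_on h cofinite_monotone_injections")
    case True
    then show ?thesis using assms(2) by (simp add: mon_def carrier)
  next
    case False
    then show ?thesis
      using collapse_imp_cyclic_subgroup[OF noninjective_collapse] by (simp add: carrier)
  qed
qed

end
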